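(* Let $F$ be a positive integer such that $N=2F^2$ is a friend of $20$. Then $F$ is not square-free.
   Context: For a positive integer $n$, $\sigma(n)$ denotes the sum of the positive divisors of $n$, and the abundancy index of $n$ is $I(n)=\sigma(n)/n$. A positive integer $N>20$ is called a friend of $20$ if $I(N)=I(20)=21/10$. *)

theory Defs
  imports Complex_Main "HOL-Computational_Algebra.Squarefree"
begin

definition divisor_sigma :: "nat \<Rightarrow> nat" where
  "divisor_sigma n = (\<Sum>d | d dvd n. d)"

definition abundancy_index :: "nat \<Rightarrow> rat" where
  "abundancy_index n = of_nat (divisor_sigma n) / of_nat n"

definition friend_of_20 :: "nat \<Rightarrow> bool" where
  "friend_of_20 N \<longleftrightarrow> N > 20 \<and> abundancy_index N = abundancy_index 20"

lemma abundancy_index_20: "abundancy_index 20 = 21 / 10"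
proof -
  have "{d::nat. d dvd 20} = Set.filter (\<lambda>d. d dvd 20) {0..20}"
    by (auto dest: dvd_imp_le)
  also have "\<dots> = {1, 2, 4, 5, 10, 20}"
    by code_simp
  finally have "divisor_sigma 20 = 42"
    by (simp add: divisor_sigma_def)
  then show ?thesis
    by (simp add: abundancy_index_def)
qed

end

theory Submission
  imports Defs "HOL-Number_Theory.Cong"
begin

text \<open>
  The equation reads \<open>5 \<sigma>(2F\<^sup>2) = 21 F\<^sup>2\<close>, so \<open>5\<close> divides \<open>F\<close>. If \<open>F\<close> is square-free, every odd
  prime \<open>p\<close> dividing \<open>F\<close> contributes the factor \<open>\<sigma>(p\<^sup>2) = 1 + p + p\<^sup>2\<close> to \<open>\<sigma>(2F\<^sup>2)\<close>. From
  \<open>\<sigma>(5\<^sup>2) = 31\<close> and \<open>\<sigma>(31\<^sup>2) = 3 \<cdot> 331\<close> one obtains that \<open>31\<close> and \<open>331\<close> divide \<open>F\<close>. Both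
  are \<open>1\<close> modulo \<open>3\<close>, so \<open>9\<close> divides \<open>21 F\<^sup>2\<close> and \<open>3\<close> divides \<open>F\<close>. Then \<open>\<sigma>(3\<^sup>2) = 13\<close> and
  \<open>\<sigma>(13\<^sup>2) = 3 \<cdot> 61\<close> give the divisors \<open>13\<close> and \<open>61\<close>, again \<open>1\<close> modulo \<open>3\<close>. Hence \<open>3^4\<close>
  divides \<open>\<sigma>(2F\<^sup>2)\<close>, whereas \<open>21 F\<^sup>2\<close> is divisible by \<open>3\<close> exactly three times.
\<close>

text \<open>Multiplication maps pairs of divisors of \<open>m\<close> and \<open>n\<close> onto the
  divisors of \<open>m * n\<close>; coprimality makes this map injective.\<close>

lemma divisor_sigma_mult_coprime:
  assumes "coprime m n"
  shows "divisor_sigma (m * n) = divisor_sigma m * divisor_sigma n"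
proof -
  have inj: "inj_on (\<lambda>(a, b). a * b) ({d. d dvd m} \<times> {d. d dvd n})"
  proof (intro inj_onI, clarify)
    fix a b c d
    assume dvd: "a dvd m" "b dvd n" "c dvd m" "d dvd n" and eq: "a * b = c * d"
    have "coprime a d" "coprime c b"
      using assms dvd by (auto intro: coprime_divisors)
    moreover have "a dvd c * d" "c dvd a * b"
      using eq by (metis dvd_triv_left)+
    ultimately have "a = c"
      by (simp add: coprime_dvd_mult_left_iff dvd_antisym)
    moreover have "coprime b c" "coprime d a"
      using \<open>coprime a d\<close> \<open>coprime c b\<close> by (simp_all add: coprime_commute)
    then have "b = d"
      using eq by (metis coprime_dvd_mult_right_iff dvd_antisym dvd_triv_right)
    ultimately show "a = c \<and> b = d" by simp
  qed
  have "{d. d dvd m * n} = (\<lambda>(a, b). a * b) ` ({d. d dvd m} \<times> {d. d dvd n})"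
    by (auto intro: mult_dvd_mono dest!: division_decomp)
  then have "divisor_sigma (m * n) = (\<Sum>(a, b)\<in>{d. d dvd m} \<times> {d. d dvd n}. a * b)"
    using inj by (simp add: divisor_sigma_def sum.reindex case_prod_unfold)
  then show ?thesis
    by (simp add: divisor_sigma_def sum_product sum.cartesian_product)
qed

lemma divisor_sigma_prime_square:
  assumes "prime p"
  shows "divisor_sigma (p\<^sup>2) = 1 + p + p\<^sup>2"
proof -
  have "{d. d dvd p\<^sup>2} = (\<lambda>i. p ^ i) ` {..2}"
    using divides_primepow_nat[OF assms] by auto
  also have "{..2} = {0, 1, 2::nat}" by auto
  finally have "{d. d dvd p\<^sup>2} = {1, p, p\<^sup>2}" by simp
  moreover have "p > 1" using assms by (rule prime_gt_1_nat)
  moreover have "p < p\<^sup>2" using \<open>p > 1\<close> by (simp add: power2_eq_square)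
  ultimately show ?thesis by (simp add: divisor_sigma_def)
qed

text \<open>A common divisor of \<open>P\<close> and its cofactor in \<open>F\<close> has its square
  dividing \<open>F\<close>, so it is a unit. As \<open>P\<close> is odd, \<open>P\<^sup>2\<close>
  is then a coprime factor of \<open>2 * F\<^sup>2\<close>.\<close>

lemma divisor_sigma_square_dvd:
  assumes "squarefree F" "P dvd F" "odd P"
  shows "divisor_sigma (P\<^sup>2) dvd divisor_sigma (2 * F\<^sup>2)"
proof -
  obtain c where c: "F = P * c" using assms(2) by auto
  have "coprime P c"
    using assms(1) c by (auto simp: squarefree_def power2_eq_square intro!: coprimeI mult_dvd_mono)
  then have "coprime (P\<^sup>2) (2 * c\<^sup>2)" using assms(3) by simp
  moreover have "2 * F\<^sup>2 = P\<^sup>2 * (2 * c\<^sup>2)" by (simp add: c power_mult_distrib)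
  ultimately show ?thesis by (metis divisor_sigma_mult_coprime dvd_triv_left)
qed

lemma three_dvd_divisor_sigma_prime_square:
  assumes "prime p" "p mod 3 = 1"
  shows "3 dvd divisor_sigma (p\<^sup>2)"
proof -
  have "[1 + p + p\<^sup>2 = 1 + 1 + 1\<^sup>2] (mod 3)"
    using assms(2) by (intro cong_add cong_pow cong_refl) (simp_all add: cong_def)
  then show ?thesis
    by (simp add: divisor_sigma_prime_square[OF assms(1)] cong_def mod_eq_0_iff_dvd)
qed

lemma three_power_dvd_divisor_sigma:
  assumes "squarefree F" "finite A"
    and A: "\<And>p. p \<in> A \<Longrightarrow> prime p \<and> odd p \<and> p mod 3 = 1 \<and> p dvd F"
  shows "3 ^ card A dvd divisor_sigma (2 * F\<^sup>2)"
proof -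
  \<comment> \<open>The factors 3 are collected on the product of \<open>A\<close>, itself an odd
    divisor of \<open>F\<close>, so that the preceding divisibility applies once to the whole
    product.\<close>
  have "3 ^ card A dvd divisor_sigma ((\<Prod>A)\<^sup>2) \<and> \<Prod>A dvd F \<and> odd (\<Prod>A)"
    using assms(2) A
  proof (induction A rule: finite_induct)
    case empty
    show ?case by (simp add: divisor_sigma_def)
  next
    case (insert p A)
    then have IH: "3 ^ card A dvd divisor_sigma ((\<Prod>A)\<^sup>2)" "\<Prod>A dvd F" "odd (\<Prod>A)"
      and p: "prime p" "odd p" "p mod 3 = 1" "p dvd F"
      by auto
    have "coprime p (\<Prod>A)"
      using insert by (intro prod_coprime_right primes_coprime) auto
    moreover from this have "divisor_sigma ((p * \<Prod>A)\<^sup>2) =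
        divisor_sigma (p\<^sup>2) * divisor_sigma ((\<Prod>A)\<^sup>2)"
      by (simp add: power_mult_distrib divisor_sigma_mult_coprime)
    ultimately show ?case
      using insert.hyps IH p three_dvd_divisor_sigma_prime_square[OF p(1,3)]
      by (auto intro: mult_dvd_mono divides_mult)
  qed
  then show ?thesis
    using divisor_sigma_square_dvd[OF assms(1)] by (blast intro: dvd_trans)
qed

theorem corollary6:
  fixes F :: nat
  assumes "F > 0" and "friend_of_20 (2 * F\<^sup>2)"
  shows "\<not> squarefree F"
proof
  assume sf: "squarefree F"
  define s where "s = divisor_sigma (2 * F\<^sup>2)"
  have "of_nat s / of_nat (2 * F\<^sup>2) = (21 / 10 :: rat)"
    using assms(2) abundancy_index_20
    by (simp add: friend_of_20_def abundancy_index_def s_def)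
  then have "(of_nat (5 * s) :: rat) = of_nat (21 * F\<^sup>2)"
    using assms(1) by (simp add: field_simps)
  then have eq: "5 * s = 21 * F\<^sup>2" by (simp only: of_nat_eq_iff)
  \<comment> \<open>By \<open>eq\<close>, a prime other than 3 and 7 that divides
    \<open>5 * s\<close> must divide \<open>F\<^sup>2\<close>.\<close>
  have step: "p dvd F" if "prime p" "\<not> p dvd 21" "p dvd 5 * s" for p
  proof -
    have "p dvd F\<^sup>2"
      using that unfolding eq by (simp add: prime_dvd_mult_iff)
    with that(1) show ?thesis by (rule prime_dvd_power)
  qed
  have sigma: "1 + p + p\<^sup>2 dvd 5 * s" if "prime p" "p dvd F" "odd p" for p
    using divisor_sigma_square_dvd[OF sf that(2,3)] divisor_sigma_prime_square[OF that(1)]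
    by (simp add: s_def)
  have pr: "prime (3::nat)" "prime (5::nat)" "prime (13::nat)" "prime (31::nat)"
    "prime (61::nat)" "prime (331::nat)" by simp_all
  have d5: "5 dvd F"
    by (rule step[OF pr(2)]) simp_all
  have d31: "31 dvd F"
    using sigma[OF pr(2) d5] by (intro step[OF pr(4)]) simp_all
  have "331 * 3 dvd 5 * s" using sigma[OF pr(4) d31] by simp
  then have "331 dvd 5 * s" by (rule dvd_mult_left)
  then have d331: "331 dvd F" by (intro step[OF pr(6)]) simp_all
  have "3 ^ card {31, 331 :: nat} dvd s"
    unfolding s_def using pr d31 d331 by (intro three_power_dvd_divisor_sigma[OF sf])
      (auto simp del: prime_nat_numeral_eq)
  then have "9 dvd 21 * F\<^sup>2"
    unfolding eq[symmetric] by simp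
  \<comment> \<open>Only one of the two factors 3 can come from 21.\<close>
  then have "3 dvd F\<^sup>2" by presburger
  with pr(1) have d3: "3 dvd F" by (rule prime_dvd_power)
  have d13: "13 dvd F"
    using sigma[OF pr(1) d3] by (intro step[OF pr(3)]) simp_all
  have "61 * 3 dvd 5 * s" using sigma[OF pr(3) d13] by simp
  then have "61 dvd 5 * s" by (rule dvd_mult_left)
  then have d61: "61 dvd F" by (intro step[OF pr(5)]) simp_all
  have "3 ^ card {31, 331, 13, 61 :: nat} dvd s"
    unfolding s_def using pr d31 d331 d13 d61
    by (intro three_power_dvd_divisor_sigma[OF sf])
      (auto simp del: prime_nat_numeral_eq)
  then have "81 dvd 21 * F\<^sup>2"
    unfolding eq[symmetric] by simp
  moreover obtain k where k: "F = 3 * k" using d3 by auto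
  \<comment> \<open>Here \<open>21 * F\<^sup>2\<close> equals \<open>189 * k\<^sup>2\<close>, and
    \<open>189 = 7 * 3 ^ 3\<close>; the fourth factor 3 must come from \<open>k\<close>.\<close>
  ultimately have "3 * 3 ^ 3 dvd (7 * k\<^sup>2) * 3 ^ 3"
    by (simp add: k power_mult_distrib)
  then have "3 dvd 7 * k\<^sup>2" by (subst (asm) dvd_times_right_cancel_iff) simp_all
  then have "3 dvd k\<^sup>2" by presburger
  with pr(1) have "3 dvd k" by (rule prime_dvd_power)
  then have "3\<^sup>2 dvd F" by (auto simp: k power2_eq_square)
  with sf have "3 dvd (1::nat)" by (rule squarefreeD)
  then show False by simp
qed

end
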